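(* For any prime $p$, the regular $p$-gon is canonically Ramsey; that is, if $C\subset\mathbb{R}^2$ is the vertex set of a regular $p$-gon, then there exist a positive integer $N$ and a finite set $S\subset\mathbb{R}^{N}$ such that every colouring of $S$ (with any number of colours) contains either a monochromatic copy of $C$ or a rainbow copy of $C$.
   Context: A configuration is a finite set of points in some $\mathbb{R}^n$; for $n<n'$ we regard $\mathbb{R}^n\subset\mathbb{R}^{n'}$ in the usual way. A copy of a configuration $C$ in a set $S$ is a subset $X\subset S$ such that there is a surjective isometry (for Euclidean distance) $C\to X$. A colouring of $S$ is an arbitrary map from $S$ to some set, with no bound on the number of colours (equivalently, an equivalence relation on $S$). A copy $X$ is monochromatic if all its points receive the same colour, and rainbow if its points receive pairwise different colours. The regular $p$-gon is identified with its set of $p$ vertices; for $p=2$ it is understood as a pair of distinct points. *)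

theory Defs
  imports "HOL-Analysis.Analysis" "HOL-Computational_Algebra.Primes"
begin

text \<open>
  \<open>topspace (Euclidean_space n)\<close> is the set of all \<open>x :: nat \<Rightarrow> real\<close> that vanish at every index
  \<open>i \<ge> n\<close>. It serves as the carrier of n-dimensional real space: the dimension is an ordinary
  natural number, and the spaces are nested along the standard inclusions.
\<close>

definition configuration :: "nat \<Rightarrow> (nat \<Rightarrow> real) set \<Rightarrow> bool" where
  "configuration n C \<longleftrightarrow> finite C \<and> C \<subseteq> topspace (Euclidean_space n)"

definition edist :: "nat \<Rightarrow> (nat \<Rightarrow> real) \<Rightarrow> (nat \<Rightarrow> real) \<Rightarrow> real" where
  "edist n x y = L2_set (\<lambda>i. x i - y i) {..<n}"

lemma edist_mono_dim:
  assumes "n \<le> m" "x \<in> topspace (Euclidean_space n)" "y \<in> topspace (Euclidean_space n)"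
  shows "edist m x y = edist n x y"
proof -
  have "(\<Sum>i<m. (x i - y i)\<^sup>2) = (\<Sum>i<n. (x i - y i)\<^sup>2)"
    using assms by (intro sum.mono_neutral_right) (auto simp: topspace_Euclidean_space)
  then show ?thesis
    by (simp add: edist_def L2_set_def)
qed

definition copy_in ::
    "nat \<Rightarrow> (nat \<Rightarrow> real) set \<Rightarrow> nat \<Rightarrow> (nat \<Rightarrow> real) set \<Rightarrow> (nat \<Rightarrow> real) set \<Rightarrow> bool" where
  "copy_in n C N S X \<longleftrightarrow>
     X \<subseteq> S \<and> (\<exists>f. f ` C = X \<and> (\<forall>x\<in>C. \<forall>y\<in>C. edist N (f x) (f y) = edist n x y))"

text \<open>
  A colouring is given by the equivalence relation "has the same colour as", which imposes no bound
  on the number of colours.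
\<close>

definition monochromatic :: "('a \<times> 'a) set \<Rightarrow> 'a set \<Rightarrow> bool" where
  "monochromatic R X \<longleftrightarrow> (\<forall>x\<in>X. \<forall>y\<in>X. (x, y) \<in> R)"

definition rainbow :: "('a \<times> 'a) set \<Rightarrow> 'a set \<Rightarrow> bool" where
  "rainbow R X \<longleftrightarrow> (\<forall>x\<in>X. \<forall>y\<in>X. x \<noteq> y \<longrightarrow> (x, y) \<notin> R)"

definition canonically_Ramsey :: "nat \<Rightarrow> (nat \<Rightarrow> real) set \<Rightarrow> bool" where
  "canonically_Ramsey n C \<longleftrightarrow>
     (\<exists>N S. N > 0 \<and> configuration N S \<and>
        (\<forall>R. equiv S R \<longrightarrow> (\<exists>X. copy_in n C N S X \<and> (monochromatic R X \<or> rainbow R X))))"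

text \<open>
  The same notion in terms of colour maps. The left-to-right direction holds for every type of
  colours, with \<open>N\<close> and \<open>S\<close> not depending on that type; conversely, colours taken from the type of
  points suffice.
\<close>

lemma equiv_colouring: "equiv S {(x, y). x \<in> S \<and> y \<in> S \<and> c x = c y}"
  by (rule equivI) (auto simp: refl_on_def sym_def trans_def)

lemma all_equiv_imp_all_colourings:
  fixes c :: "(nat \<Rightarrow> real) \<Rightarrow> 'c"
  assumes "\<forall>R. equiv S R \<longrightarrow> (\<exists>X. copy_in n C N S X \<and> (monochromatic R X \<or> rainbow R X))"
  shows "\<exists>X. copy_in n C N S X \<and> ((\<forall>x\<in>X. \<forall>y\<in>X. c x = c y) \<or> inj_on c X)"
proof -
  define R where "R = {(x, y). x \<in> S \<and> y \<in> S \<and> c x = c y}"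
  obtain X where X: "copy_in n C N S X" "monochromatic R X \<or> rainbow R X"
    using assms equiv_colouring[of S c] unfolding R_def by blast
  have "X \<subseteq> S"
    using X(1) by (simp add: copy_in_def)
  then have "(\<forall>x\<in>X. \<forall>y\<in>X. c x = c y) \<or> inj_on c X"
    using X(2) unfolding monochromatic_def rainbow_def R_def inj_on_def by blast
  with X(1) show ?thesis by blast
qed

lemma canonically_Ramsey_iff_colourings:
  "canonically_Ramsey n C \<longleftrightarrow>
     (\<exists>N S. N > 0 \<and> configuration N S \<and>
        (\<forall>c :: (nat \<Rightarrow> real) \<Rightarrow> (nat \<Rightarrow> real).
           \<exists>X. copy_in n C N S X \<and> ((\<forall>x\<in>X. \<forall>y\<in>X. c x = c y) \<or> inj_on c X)))"
  (is "_ \<longleftrightarrow> ?rhs")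
proof
  assume "canonically_Ramsey n C"
  then obtain N S where NS: "N > 0" "configuration N S"
    "\<forall>R. equiv S R \<longrightarrow> (\<exists>X. copy_in n C N S X \<and> (monochromatic R X \<or> rainbow R X))"
    unfolding canonically_Ramsey_def by blast
  show ?rhs
    using NS(1,2) all_equiv_imp_all_colourings[OF NS(3)] by blast
next
  assume ?rhs
  then obtain N S where NS: "N > 0" "configuration N S"
    "\<And>c :: (nat \<Rightarrow> real) \<Rightarrow> (nat \<Rightarrow> real).
       \<exists>X. copy_in n C N S X \<and> ((\<forall>x\<in>X. \<forall>y\<in>X. c x = c y) \<or> inj_on c X)"
    by blast
  have "\<exists>X. copy_in n C N S X \<and> (monochromatic R X \<or> rainbow R X)" if R: "equiv S R" for R
  proof -
    define c where "c x = (SOME y. (x, y) \<in> R)" for x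
    have c: "c x = c y \<longleftrightarrow> (x, y) \<in> R" if "x \<in> S" "y \<in> S" for x y
    proof
      assume "c x = c y"
      moreover have "(z, c z) \<in> R" if "z \<in> S" for z
        unfolding c_def using R that by (metis equiv_class_self Image_singleton_iff someI)
      ultimately show "(x, y) \<in> R"
        using R \<open>x \<in> S\<close> \<open>y \<in> S\<close> by (metis equiv_def symD transD)
    next
      assume "(x, y) \<in> R"
      then have "(x, z) \<in> R \<longleftrightarrow> (y, z) \<in> R" for z
        using R by (metis equiv_def symD transD)
      then show "c x = c y" by (simp add: c_def)
    qed
    obtain X where X: "copy_in n C N S X" "(\<forall>x\<in>X. \<forall>y\<in>X. c x = c y) \<or> inj_on c X"
      using NS(3) by blast
    have "X \<subseteq> S"
      using X(1) by (simp add: copy_in_def)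
    then have "monochromatic R X \<or> rainbow R X"
      using X(2) c unfolding monochromatic_def rainbow_def inj_on_def by blast
    with X(1) show ?thesis by blast
  qed
  with NS(1,2) show "canonically_Ramsey n C"
    unfolding canonically_Ramsey_def by blast
qed

text \<open>
  The polygon has centre \<open>(a, b)\<close>, circumradius \<open>r\<close> and rotation angle \<open>t\<close>; for \<open>p = 2\<close> this gives
  exactly the pairs of distinct points of the plane.
\<close>

definition regular_polygon :: "nat \<Rightarrow> (nat \<Rightarrow> real) set \<Rightarrow> bool" where
  "regular_polygon p C \<longleftrightarrow>
     (\<exists>a b r t. r > 0 \<and>
        C = (\<lambda>k i. if i = 0 then a + r * cos (t + 2 * pi * real k / real p)
                   else if i = 1 then b + r * sin (t + 2 * pi * real k / real p)
                   else 0) ` {..<p})"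

lemma configuration_regular_polygon: "regular_polygon p C \<Longrightarrow> configuration 2 C"
  by (auto simp: regular_polygon_def configuration_def topspace_Euclidean_space)

lemma card_regular_polygon:
  assumes "regular_polygon p C"
  shows "card C = p"
proof -
  obtain a b r t where r: "r > 0" and C: "C = (\<lambda>k i :: nat.
                   if i = 0 then a + r * cos (t + 2 * pi * real k / real p)
                   else if i = 1 then b + r * sin (t + 2 * pi * real k / real p)
                   else 0) ` {..<p}" (is "_ = ?v ` _")
    using assms unfolding regular_polygon_def by blast
  have "inj_on ?v {..<p}"
  proof (rule inj_onI)
    fix j k assume jk: "j \<in> {..<p}" "k \<in> {..<p}" and eq: "?v j = ?v k"
    have "cos (t + 2 * pi * real j / real p) = cos (t + 2 * pi * real k / real p)"
      using fun_cong[OF eq, of 0] r by simp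
    moreover have "sin (t + 2 * pi * real j / real p) = sin (t + 2 * pi * real k / real p)"
      using fun_cong[OF eq, of 1] r by simp
    ultimately obtain n :: int where
      "t + 2 * pi * real j / real p = t + 2 * pi * real k / real p + 2 * pi * n"
      using sin_cos_eq_iff[of "t + 2 * pi * real j / real p" "t + 2 * pi * real k / real p"] by blast
    then have "2 * pi * (real j / real p) = 2 * pi * (real k / real p + n)"
      by (simp add: algebra_simps)
    then have "real j / real p = real k / real p + n"
      by (simp del: times_divide_eq_right)
    moreover have "p > 0" using jk by auto
    ultimately have "real j = real k + real p * n"
      by (simp add: field_simps)
    then have "real_of_int (int j) = real_of_int (int k + int p * n)"
      by simp
    then have "int j = int k + int p * n"
      by (simp only: of_int_eq_iff)
    then have "int j mod int p = int k mod int p"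
      by simp
    with jk show "j = k" by simp
  qed
  then show ?thesis
    by (simp add: C card_image)
qed

lemma regular_polygon_2_iff:
  "regular_polygon 2 C \<longleftrightarrow>
     (\<exists>x\<in>topspace (Euclidean_space 2). \<exists>y\<in>topspace (Euclidean_space 2). x \<noteq> y \<and> C = {x, y})"
proof
  assume C: "regular_polygon 2 C"
  obtain x y where "C = {x, y}" "x \<noteq> y"
    using card_regular_polygon[OF C] by (auto simp: card_2_iff)
  then show "\<exists>x\<in>topspace (Euclidean_space 2). \<exists>y\<in>topspace (Euclidean_space 2). x \<noteq> y \<and> C = {x, y}"
    using configuration_regular_polygon[OF C] by (auto simp: configuration_def)
next
  assume "\<exists>x\<in>topspace (Euclidean_space 2). \<exists>y\<in>topspace (Euclidean_space 2). x \<noteq> y \<and> C = {x, y}"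
  then obtain x y where x: "\<forall>i\<ge>2. x i = 0" and y: "\<forall>i\<ge>2. y i = 0"
    and xy: "x \<noteq> y" and C: "C = {x, y}"
    by (auto simp: topspace_Euclidean_space)
  define z where "z = Complex ((x 0 - y 0) / 2) ((x 1 - y 1) / 2)"
  have "z \<noteq> 0"
  proof
    assume "z = 0"
    then have 01: "x 0 = y 0" "x 1 = y 1"
      by (auto simp: z_def complex_eq_iff)
    have "x i = y i" for i
    proof -
      consider "i = 0" | "i = 1" | "i \<ge> 2" by linarith
      then show ?thesis using 01 x y by cases auto
    qed
    with xy show False by auto
  qed
  define r t where "r = cmod z" and "t = Arg z"
  have "z = rcis r t"
    by (simp add: r_def t_def rcis_cmod_Arg)
  then have z: "r * cos t = (x 0 - y 0) / 2" "r * sin t = (x 1 - y 1) / 2"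
    by (metis Re_rcis z_def complex.sel(1), metis Im_rcis \<open>z = rcis r t\<close> z_def complex.sel(2))
  define a b where "a = (x 0 + y 0) / 2" and "b = (x 1 + y 1) / 2"
  let ?v = "\<lambda>(k::nat) (i::nat). if i = 0 then a + r * cos (t + 2 * pi * real k / real 2)
                   else if i = 1 then b + r * sin (t + 2 * pi * real k / real 2)
                   else 0"
  have ge2: "i \<ge> 2" if "i \<noteq> 0" "i \<noteq> Suc 0" for i :: nat
    using that by linarith
  have "?v 0 = x"
    using z x by (auto simp: fun_eq_iff a_def b_def ge2 field_simps)
  moreover have "?v 1 = y"
    using z y by (auto simp: fun_eq_iff a_def b_def ge2 field_simps)
  moreover have "{..<2::nat} = {0, 1}" by auto
  ultimately have "C = ?v ` {..<2}"
    unfolding C by (simp only: image_insert image_empty)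
  moreover have "r > 0" using \<open>z \<noteq> 0\<close> by (simp add: r_def)
  ultimately show "regular_polygon 2 C"
    unfolding regular_polygon_def by (intro exI[of _ a] exI[of _ b] exI[of _ r] exI[of _ t]) simp
qed

end

theory Submission
  imports "HOL-Library.Ramsey" "HOL-Number_Theory.Cong" Defs
begin

text \<open>
  A colouring of a single \<open>p\<close>-gon that looks the same after rotating the polygon by one step is a
  translation-invariant equivalence relation on the integers modulo a prime, that is, the partition
  into cosets of a subgroup; so it is either constant or injective. The aim is therefore to find a
  copy of the polygon on which the colouring is, in this sense, blind to rotation.

  Copies are looked for among words over the alphabet \<open>{..<p}\<close>. A letter \<open>a\<close> stands for the vertex
  number \<open>a\<close> of a small \<open>p\<close>-gon, and a word of length \<open>N\<close> for a point in the product of \<open>N\<close> planes.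
  If \<open>D\<close> coordinates of a word are advanced simultaneously by \<open>0, 1, ..., p - 1\<close> (modulo \<open>p\<close>) while
  the others stay fixed, the \<open>p\<close> resulting points form a regular \<open>p\<close>-gon that is larger by the factor
  \<open>sqrt D\<close>. A relation \<open>R\<close> between words is studied through the list of columns \<open>(a, b)\<close> in which a
  pair of words is read off coordinate by coordinate.

  Ramsey's theorem, applied to the set of positions carrying a word (all other positions carry 0),
  yields a subsystem on which \<open>R u v\<close> is unaffected by inserting, deleting or moving columns \<open>(0, 0)\<close>.
  To make the other diagonal columns \<open>(a, a)\<close> equally invisible, replace every letter \<open>a\<close> by the block
  \<open>a, a + 1, ..., p - 1, 0, ..., a - 1\<close>. Suppose that the columns \<open>(s, s)\<close> with \<open>s < t\<close> are invisible
  already. Then for each \<open>a \<le> t\<close> the block pair belonging to \<open>(a, a)\<close> shows exactly the columns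
  \<open>(t, t), ..., (p - 1, p - 1)\<close>, so these diagonal columns can be exchanged for \<open>(0, 0)\<close>; another
  application of Ramsey's theorem makes all of them invisible (\<open>forgets_diagonal_step\<close>). After \<open>p\<close>
  rounds the whole diagonal is invisible (\<open>ramsey_forgets_diagonal\<close>).

  An equivalence relation with invisible diagonal is rigid. Say that letters \<open>a\<close> and \<open>b\<close> commute if the
  words \<open>ab\<close> and \<open>ba\<close> are related. Inserting a letter at two different places shows that two related
  words carry commuting letters at every position (\<open>sim_imp_commute\<close>), and that commuting is
  transitive. Consider the \<open>p\<close> rotations of the word \<open>0 1 ... p - 1\<close>; they form a copy of the polygon.
  If all letters commute, these rotations are all related. If two different rotations are related,
  then every \<open>a\<close> commutes with \<open>a + \<delta>\<close> modulo \<open>p\<close> for a fixed nonzero \<open>\<delta>\<close>, hence, \<open>p\<close> being prime, all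
  letters commute. So the copy is monochromatic or rainbow (\<open>windings_mono_or_rainbow\<close>).
\<close>

section \<open>Words spread over a set of positions\<close>

definition words :: "'a set \<Rightarrow> nat \<Rightarrow> 'a list set" where
  "words A n = {w. set w \<subseteq> A \<and> length w = n}"

lemma finite_words: "finite A \<Longrightarrow> finite (words A n)"
  unfolding words_def by (rule finite_lists_length_eq)

text \<open>
  The infinite word that carries the letters of a finite word at the listed positions, in this order,
  and the blank \<open>z\<close> elsewhere.
\<close>

fun place :: "'a \<Rightarrow> nat list \<Rightarrow> 'a list \<Rightarrow> nat \<Rightarrow> 'a" where
  "place z (x # xs) (c # cs) = (place z xs cs)(x := c)"
| "place z _ _ = (\<lambda>_. z)"

definition spread :: "'a \<Rightarrow> nat \<Rightarrow> nat list \<Rightarrow> 'a list \<Rightarrow> 'a list" where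
  "spread z M xs cs = map (place z xs cs) [0..<M]"

lemma place_outside: "j \<notin> set xs \<Longrightarrow> place z xs cs j = z"
  by (induction z xs cs rule: place.induct) auto

lemma place_in: "z \<in> A \<Longrightarrow> set cs \<subseteq> A \<Longrightarrow> place z xs cs j \<in> A"
  by (induction z xs cs rule: place.induct) auto

lemma map_place: "f (place z xs cs j) = place (f z) xs (map f cs) j"
  by (induction z xs cs rule: place.induct) auto

lemma spread_in_words: "z \<in> A \<Longrightarrow> cs \<in> words A n \<Longrightarrow> spread z M xs cs \<in> words A M"
  using place_in[of z A cs xs] by (auto simp: words_def spread_def)

lemma map_spread: "map f (spread z M xs cs) = spread (f z) M xs (map f cs)"
  by (simp add: spread_def map_place[of f z xs cs])

text \<open>
  A letter that equals the blank \<open>z\<close> can be dropped together with its position: the spread word only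
  remembers where the other letters are.
\<close>

lemma place_drop_blanks:
  assumes "length xs = length cs" "sorted_wrt (<) xs"
  shows "\<exists>ys. sorted_wrt (<) ys \<and> set ys \<subseteq> set xs \<and> length ys = length (filter (\<lambda>c. c \<noteq> z) cs)
    \<and> place z xs cs = place z ys (filter (\<lambda>c. c \<noteq> z) cs)"
  using assms
proof (induction xs cs rule: list_induct2)
  case Nil
  show ?case by (intro exI[of _ "[]"]) simp
next
  case (Cons x xs c cs)
  then obtain ys where ys: "sorted_wrt (<) ys" "set ys \<subseteq> set xs"
    "length ys = length (filter (\<lambda>c. c \<noteq> z) cs)"
    "place z xs cs = place z ys (filter (\<lambda>c. c \<noteq> z) cs)"
    by auto
  show ?case
  proof (cases "c = z")
    case True
    have "x \<notin> set xs" using Cons.prems by auto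
    then have "place z (x # xs) (c # cs) = place z xs cs"
      using True by (auto simp: fun_eq_iff place_outside)
    then show ?thesis using ys True by (intro exI[of _ ys]) auto
  next
    case False
    have "sorted_wrt (<) (x # ys)" using ys Cons.prems by auto
    then show ?thesis using ys False by (intro exI[of _ "x # ys"]) auto
  qed
qed

text \<open>
  Conversely, blanks may be appended at will. Together with the previous lemma this turns a word of
  fixed length into one with all its blanks at the end, without changing the word it spreads to.
\<close>

lemma place_pad_blanks:
  "length ys = length ls \<Longrightarrow> place z (ys @ zs) (ls @ replicate k z) = place z ys ls"
proof (induction ys ls rule: list_induct2)
  case Nil
  have "place z zs (replicate k z) = (\<lambda>_. z)"
  proof (induction zs arbitrary: k)
    case (Cons x zs)
    then show ?case by (cases k) auto
  qed simp
  then show ?case by simp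
qed simp

section \<open>Making the blank invisible by Ramsey's theorem\<close>

text \<open>
  Ramsey's theorem for hypergraphs, with the colours taken from an arbitrary finite set.
\<close>

lemma ramsey_finite_colours:
  assumes "finite D"
  shows "\<exists>M. \<forall>f. (\<forall>T. f T \<in> D) \<longrightarrow>
    (\<exists>H c. H \<subseteq> {..<M::nat} \<and> card H = n \<and> (\<forall>T. T \<subseteq> H \<and> card T = r \<and> finite T \<longrightarrow> f T = c))"
proof -
  obtain h k where h: "bij_betw h D {0..<k::nat}"
    using ex_bij_betw_finite_nat[OF assms] by blast
  obtain M :: nat where M: "partn_lst {..<M} (replicate k n) r"
    using ramsey_full by blast
  show ?thesis
  proof (intro exI[of _ M] allI impI)
    fix f :: "nat set \<Rightarrow> 'a" assume f: "\<forall>T. f T \<in> D"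
    then have "(\<lambda>T. h (f T)) \<in> nsets {..<M} r \<rightarrow> {..<k}"
      using bij_betwE[OF h] by auto
    then obtain i H where i: "i < k" "H \<in> nsets {..<M} (replicate k n ! i)"
      "(\<lambda>T. h (f T)) ` nsets H r \<subseteq> {i}"
      by (rule partn_lstE[OF M]) auto
    then have H: "H \<subseteq> {..<M}" "card H = n" by (auto simp: nsets_def)
    have c: "f T = inv_into D h i" if "T \<subseteq> H \<and> card T = r \<and> finite T" for T
    proof -
      have "h (f T) = i" using i(3) that by (auto simp: nsets_def)
      then show ?thesis using f h by (metis bij_betw_inv_into_left)
    qed
    then show "\<exists>H c. H \<subseteq> {..<M} \<and> card H = n \<and> (\<forall>T. T \<subseteq> H \<and> card T = r \<and> finite T \<longrightarrow> f T = c)"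
      using H c by (intro exI[of _ H] exI[of _ "inv_into D h i"] conjI allI impI)
  qed
qed

text \<open>
  The position sets of size \<open>m\<close> are coloured by the set of words whose spread version satisfies \<open>Q\<close>.
  A homogeneous set with twice as many elements as needed leaves \<open>m\<close> spare positions to the right of
  the chosen ones. They allow the blanks inside a word to be traded for blanks at its end: the
  nonblank letters keep their actual positions, and homogeneity moves the result back.
\<close>

lemma ramsey_blanks:
  assumes "finite A" "z \<in> A"
  shows "\<exists>M. \<forall>Q :: 'a list \<Rightarrow> bool. \<exists>xs. sorted_wrt (<) xs \<and> set xs \<subseteq> {..<M} \<and> length xs = m \<and>
    (\<forall>cs\<in>words A m. \<forall>ds\<in>words A m. filter (\<lambda>c. c \<noteq> z) cs = filter (\<lambda>c. c \<noteq> z) ds \<longrightarrow>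
       Q (spread z M xs cs) = Q (spread z M xs ds))"
proof -
  obtain M where M: "\<forall>f. (\<forall>T. f T \<in> Pow (words A m)) \<longrightarrow>
    (\<exists>H c. H \<subseteq> {..<M::nat} \<and> card H = 2 * m \<and> (\<forall>T. T \<subseteq> H \<and> card T = m \<and> finite T \<longrightarrow> f T = c))"
    using ramsey_finite_colours[OF finite_Pow_iff[THEN iffD2, OF finite_words[OF assms(1)]]]
    by presburger
  show ?thesis
  proof (intro exI[of _ M] allI)
    fix Q :: "'a list \<Rightarrow> bool"
    define f where "f T = {cs \<in> words A m. Q (spread z M (sorted_list_of_set T) cs)}" for T
    have "\<forall>T. f T \<in> Pow (words A m)" by (auto simp: f_def)
    from M[THEN spec, THEN mp, OF this] obtain H c where "H \<subseteq> {..<M} \<and> card H = 2 * m \<and>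
        (\<forall>T. T \<subseteq> H \<and> card T = m \<and> finite T \<longrightarrow> f T = c)"
      by (elim exE)
    then have H: "H \<subseteq> {..<M}" "card H = 2 * m"
      and c: "T \<subseteq> H \<Longrightarrow> card T = m \<Longrightarrow> finite T \<Longrightarrow> f T = c" for T
      by simp_all
    have finH: "finite H" using H(1) finite_subset by blast
    define hs where "hs = sorted_list_of_set H"
    have hs: "sorted_wrt (<) hs" "set hs = H" "length hs = 2 * m"
      using finH H(2) by (auto simp: hs_def)
    \<comment> \<open>the positions to be used, and the spare ones to their right\<close>
    define xs rs where "xs = take m hs" and "rs = drop m hs"
    have app: "hs = xs @ rs" by (simp add: xs_def rs_def)
    have len: "length xs = m" "length rs = m" using hs(3) by (auto simp: xs_def rs_def)
    have srt: "sorted_wrt (<) xs" "sorted_wrt (<) rs" "\<forall>x\<in>set xs. \<forall>y\<in>set rs. x < y"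
      using hs(1) unfolding app by (auto simp: sorted_wrt_append)
    have sub: "set xs \<subseteq> H" "set rs \<subseteq> H" using hs(2) app by auto
    have hom: "Q (spread z M ys cs) = Q (spread z M xs cs)"
      if "cs \<in> words A m" "sorted_wrt (<) ys" "set ys \<subseteq> H" "length ys = m" for cs ys
    proof -
      have 1: "f (set us) = c \<and> sorted_list_of_set (set us) = us"
        if "sorted_wrt (<) us" "set us \<subseteq> H" "length us = m" for us
        using that c[of "set us"]
        by (auto simp: strict_sorted_iff distinct_card sorted_list_of_set.idem_if_sorted_distinct)
      have "cs \<in> f (set ys) \<longleftrightarrow> cs \<in> f (set xs)"
        using 1[of ys] 1[of xs] that srt sub len by auto
      then show ?thesis using that 1[of ys] 1[of xs] srt sub len by (simp add: f_def)
    qed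
    have norm: "Q (spread z M xs cs) = Q (spread z M xs (ls @ replicate (m - length ls) z))"
      if cs: "cs \<in> words A m" and ls: "ls = filter (\<lambda>c. c \<noteq> z) cs" for cs ls
    proof -
      have lcs: "length xs = length cs" using cs len by (simp add: words_def)
      then obtain ys where ys: "sorted_wrt (<) ys" "set ys \<subseteq> set xs" "length ys = length ls"
        "place z xs cs = place z ys ls"
        using place_drop_blanks[of xs cs z] srt(1) ls by auto
      have le: "length ls \<le> m" using ls lcs len by (metis length_filter_le)
      \<comment> \<open>the positions of the nonblank letters, filled up to \<open>m\<close> by spare positions\<close>
      define us where "us = ys @ take (m - length ls) rs"
      have tk: "sorted_wrt (<) (take (m - length ls) rs)" "set (take (m - length ls) rs) \<subseteq> set rs"
        using srt(2) by (auto simp: sorted_wrt_take dest: in_set_takeD)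
      have us: "sorted_wrt (<) us" "set us \<subseteq> H" "length us = m"
        using ys tk srt sub le len unfolding us_def
        by (auto simp: sorted_wrt_append subset_iff)
      have "spread z M xs cs = spread z M us (ls @ replicate (m - length ls) z)"
        by (simp add: spread_def us_def place_pad_blanks ys)
      moreover have "ls @ replicate (m - length ls) z \<in> words A m"
        using cs ls le assms(2) by (auto simp: words_def)
      ultimately show ?thesis using hom us by simp
    qed
    have "\<forall>cs\<in>words A m. \<forall>ds\<in>words A m. filter (\<lambda>c. c \<noteq> z) cs = filter (\<lambda>c. c \<noteq> z) ds \<longrightarrow>
       Q (spread z M xs cs) = Q (spread z M xs ds)"
    proof (intro ballI impI)
      fix cs ds assume "cs \<in> words A m" "ds \<in> words A m"
        "filter (\<lambda>c. c \<noteq> z) cs = filter (\<lambda>c. c \<noteq> z) ds"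
      then show "Q (spread z M xs cs) = Q (spread z M xs ds)"
        using norm[OF _ refl, of cs] norm[OF _ refl, of ds] by simp
    qed
    then show "\<exists>xs. sorted_wrt (<) xs \<and> set xs \<subseteq> {..<M} \<and> length xs = m \<and>
      (\<forall>cs\<in>words A m. \<forall>ds\<in>words A m. filter (\<lambda>c. c \<noteq> z) cs = filter (\<lambda>c. c \<noteq> z) ds \<longrightarrow>
       Q (spread z M xs cs) = Q (spread z M xs ds))"
      using srt(1) subset_trans[OF sub(1) H(1)] len(1) by (intro exI[of _ xs] conjI)
  qed
qed

section \<open>Distances between words, and scaled embeddings\<close>

text \<open>
  When \<open>g a b\<close> is the squared distance of the vertices \<open>a\<close> and \<open>b\<close> of a polygon, this is the squared
  distance in a product of planes. Keeping \<open>g\<close> abstract separates the combinatorics from the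
  geometry: apart from vanishing on the diagonal, only invariance under rotation matters.
\<close>

definition wdist :: "(nat \<Rightarrow> nat \<Rightarrow> real) \<Rightarrow> nat list \<Rightarrow> nat list \<Rightarrow> real" where
  "wdist g u v = (\<Sum>c\<leftarrow>zip u v. g (fst c) (snd c))"

definition rotation_invariant :: "nat \<Rightarrow> (nat \<Rightarrow> nat \<Rightarrow> real) \<Rightarrow> bool" where
  "rotation_invariant p g \<longleftrightarrow> (\<forall>a. g a a = 0) \<and>
     (\<forall>a<p. \<forall>b<p. \<forall>s. g ((a + s) mod p) ((b + s) mod p) = g a b)"

text \<open>
  One full turn around the polygon that starts at the vertex \<open>a\<close>. A word is wound by replacing each of
  its letters by such a turn. Advancing a letter then advances \<open>p\<close> letters of the wound word at once,
  which multiplies the squared distances by \<open>p\<close>.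
\<close>

definition winding :: "nat \<Rightarrow> nat \<Rightarrow> nat list" where
  "winding p a = map (\<lambda>s. (a + s) mod p) [0..<p]"

definition wind :: "nat \<Rightarrow> nat list \<Rightarrow> nat list" where
  "wind p w = concat (map (winding p) w)"

lemma length_winding [simp]: "length (winding p a) = p"
  by (simp add: winding_def)

lemma set_winding: "0 < p \<Longrightarrow> set (winding p a) \<subseteq> {..<p}"
  by (auto simp: winding_def)

lemma winding_eq_rotate: "winding p a = rotate a [0..<p]"
  by (rule nth_equalityI) (auto simp: winding_def nth_rotate add.commute)

lemma winding_eq_append: "a < p \<Longrightarrow> winding p a = [a..<p] @ [0..<a]"
  unfolding winding_eq_rotate by (simp add: rotate_drop_take take_upt)

lemma wdist_append:
  "length u = length v \<Longrightarrow> wdist g (u @ u') (v @ v') = wdist g u v + wdist g u' v'"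
  by (simp add: wdist_def)

lemma wdist_winding:
  assumes "rotation_invariant p g" "a < p" "b < p"
  shows "wdist g (winding p a) (winding p b) = p * g a b"
proof -
  have "wdist g (winding p a) (winding p b) = (\<Sum>s\<leftarrow>[0..<p]. g ((a + s) mod p) ((b + s) mod p))"
    unfolding wdist_def winding_def by (simp add: zip_map_map zip_same_conv_map comp_def)
  also have "\<dots> = (\<Sum>s\<leftarrow>[0..<p]. g a b)"
    using assms by (simp add: rotation_invariant_def)
  finally show ?thesis by (simp add: sum_list_triv)
qed

lemma wind_in_words: "0 < p \<Longrightarrow> w \<in> words {..<p} n \<Longrightarrow> wind p w \<in> words {..<p} (p * n)"
  using set_winding[of p]
  by (fastforce simp: words_def wind_def length_concat comp_def sum_list_triv)

lemma wdist_wind: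
  assumes "rotation_invariant p g" "u \<in> words {..<p} n" "v \<in> words {..<p} n"
  shows "wdist g (wind p u) (wind p v) = p * wdist g u v"
proof -
  have "length u = length v" "set u \<subseteq> {..<p}" "set v \<subseteq> {..<p}"
    using assms by (auto simp: words_def)
  then show ?thesis
  proof (induction u v rule: list_induct2)
    case Nil
    then show ?case by (simp add: wdist_def wind_def)
  next
    case (Cons a u b v)
    then show ?case
      using wdist_winding[OF assms(1), of a b] wdist_append[of "winding p a" "winding p b"]
        wdist_append[of "[a]" "[b]" g u v]
      by (simp add: wind_def algebra_simps) (simp add: wdist_def)
  qed
qed

lemma sum_place:
  assumes "length xs = length cs" "distinct xs" "set xs \<subseteq> {..<M}" "G z = (0::real)"
  shows "(\<Sum>j<M. G (place z xs cs j)) = (\<Sum>c\<leftarrow>cs. G c)"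
  using assms(1-3)
proof (induction xs cs rule: list_induct2)
  case Nil
  then show ?case using assms(4) by simp
next
  case (Cons x xs c cs)
  have x: "x \<in> {..<M}" "x \<notin> set xs" using Cons.prems by auto
  have "(\<Sum>j<M. G (place z (x # xs) (c # cs) j)) = G c + (\<Sum>j\<in>{..<M}-{x}. G (place z xs cs j))"
    using x(1) by (simp add: sum.remove[of _ x])
  also have "(\<Sum>j\<in>{..<M}-{x}. G (place z xs cs j)) = (\<Sum>j<M. G (place z xs cs j))"
    using x assms(4) by (simp add: sum.remove[of "{..<M}" x] place_outside)
  finally show ?case using Cons by simp
qed

lemma zip_spread:
  assumes "length u = length v"
  shows "zip (spread a M xs u) (spread b M xs v) = spread (a, b) M xs (zip u v)"
proof -
  have "map fst (spread (a, b) M xs (zip u v)) = spread a M xs u"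
    "map snd (spread (a, b) M xs (zip u v)) = spread b M xs v"
    using assms by (simp_all add: map_spread)
  then show ?thesis by (metis zip_map_fst_snd)
qed

lemma wdist_spread:
  assumes "length xs = m" "distinct xs" "set xs \<subseteq> {..<M}" "u \<in> words A m" "v \<in> words A m" "g 0 0 = 0"
  shows "wdist g (spread 0 M xs u) (spread 0 M xs v) = wdist g u v"
proof -
  have l: "length u = length v" "length xs = length (zip u v)" using assms by (auto simp: words_def)
  have "wdist g (spread 0 M xs u) (spread 0 M xs v)
      = (\<Sum>j\<leftarrow>[0..<M]. (\<lambda>c. g (fst c) (snd c)) (place (0, 0) xs (zip u v) j))"
    unfolding wdist_def zip_spread[OF l(1)] by (simp add: spread_def comp_def)
  also have "\<dots> = (\<Sum>j<M. (\<lambda>c. g (fst c) (snd c)) (place (0, 0) xs (zip u v) j))"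
    by (simp add: interv_sum_list_conv_sum_set_nat atLeast0LessThan)
  also have "\<dots> = wdist g u v"
    unfolding wdist_def using assms l by (intro sum_place) auto
  finally show ?thesis .
qed

text \<open>
  An embedding of words that multiplies the squared distances by \<open>d\<close>, for all choices of \<open>g\<close>
  simultaneously. Such embeddings map copies of the polygon to copies of an enlarged polygon.
\<close>

definition scaled_embedding :: "nat \<Rightarrow> nat \<Rightarrow> nat \<Rightarrow> nat \<Rightarrow> (nat list \<Rightarrow> nat list) \<Rightarrow> bool" where
  "scaled_embedding p m N d e \<longleftrightarrow> e ` words {..<p} m \<subseteq> words {..<p} N \<and>
     (\<forall>g. rotation_invariant p g \<longrightarrow>
       (\<forall>u\<in>words {..<p} m. \<forall>v\<in>words {..<p} m. wdist g (e u) (e v) = d * wdist g u v))"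

lemma scaled_embeddingI:
  assumes "\<And>w. w \<in> words {..<p} m \<Longrightarrow> e w \<in> words {..<p} N"
    and "\<And>g u v. rotation_invariant p g \<Longrightarrow> u \<in> words {..<p} m \<Longrightarrow> v \<in> words {..<p} m \<Longrightarrow>
      wdist g (e u) (e v) = real d * wdist g u v"
  shows "scaled_embedding p m N d e"
  unfolding scaled_embedding_def using assms by (intro conjI image_subsetI allI impI ballI)

lemma scaled_embeddingD:
  assumes "scaled_embedding p m N d e" "u \<in> words {..<p} m"
  shows "e u \<in> words {..<p} N"
    and "rotation_invariant p g \<Longrightarrow> v \<in> words {..<p} m \<Longrightarrow> wdist g (e u) (e v) = d * wdist g u v"
  using assms unfolding scaled_embedding_def by (simp_all add: image_subset_iff)

lemma scaled_embedding_comp: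
  assumes "scaled_embedding p m N d e" "scaled_embedding p l m d' e'"
  shows "scaled_embedding p l N (d * d') (\<lambda>w. e (e' w))"
proof (rule scaled_embeddingI)
  note e = scaled_embeddingD[OF assms(1)] and e' = scaled_embeddingD[OF assms(2)]
  show "e (e' w) \<in> words {..<p} N" if "w \<in> words {..<p} l" for w
    by (rule e(1)[OF e'(1)[OF that]])
  show "wdist g (e (e' u)) (e (e' v)) = real (d * d') * wdist g u v"
    if "rotation_invariant p g" "u \<in> words {..<p} l" "v \<in> words {..<p} l" for g u v
    using e(2)[OF e'(1)[OF that(2)] that(1) e'(1)[OF that(3)]] e'(2)[OF that(2,1,3)] by simp
qed

lemma scaled_embedding_wind:
  assumes "0 < p"
  shows "scaled_embedding p n (p * n) p (wind p)"
  by (intro scaled_embeddingI wind_in_words[OF assms] wdist_wind)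

lemma scaled_embedding_spread:
  assumes "0 < p" "length xs = m" "distinct xs" "set xs \<subseteq> {..<M}"
  shows "scaled_embedding p m M 1 (spread 0 M xs)"
proof (rule scaled_embeddingI)
  show "spread 0 M xs w \<in> words {..<p} M" if "w \<in> words {..<p} m" for w
    using spread_in_words[OF _ that] assms(1) by simp
  show "wdist g (spread 0 M xs u) (spread 0 M xs v) = real 1 * wdist g u v"
    if "rotation_invariant p g" "u \<in> words {..<p} m" "v \<in> words {..<p} m" for g u v
  proof -
    have "g 0 0 = 0" using that(1) unfolding rotation_invariant_def by blast
    then show ?thesis using wdist_spread[OF assms(2-4) that(2,3), of g] by simp
  qed
qed

section \<open>Making the diagonal invisible\<close>

text \<open>
  Pairs of words are seen as words of columns \<open>(a, b)\<close>. At stage \<open>t\<close> the columns \<open>(a, a)\<close> with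
  \<open>a < t\<close> count as blanks, so that \<open>forgets_diagonal p t m R\<close> lets the remaining columns move
  freely among them.
\<close>

definition visible :: "nat \<Rightarrow> nat \<times> nat \<Rightarrow> bool" where
  "visible t c \<longleftrightarrow> \<not> (fst c = snd c \<and> fst c < t)"

definition forgets_diagonal :: "nat \<Rightarrow> nat \<Rightarrow> nat \<Rightarrow> (nat list \<Rightarrow> nat list \<Rightarrow> bool) \<Rightarrow> bool" where
  "forgets_diagonal p t m R \<longleftrightarrow>
     (\<forall>u\<in>words {..<p} m. \<forall>v\<in>words {..<p} m. \<forall>u'\<in>words {..<p} m. \<forall>v'\<in>words {..<p} m.
        filter (visible t) (zip u v) = filter (visible t) (zip u' v') \<longrightarrow> R u v = R u' v')"

text \<open>
  Here the bound is \<open>Suc t\<close>: erasing is used in the passage from stage \<open>t\<close> to stage \<open>t + 1\<close> and so has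
  to reach the column \<open>(t, t)\<close>.
\<close>

definition erase :: "nat \<Rightarrow> nat \<times> nat \<Rightarrow> nat \<times> nat" where
  "erase t c = (if visible (Suc t) c then c else (0, 0))"

lemma filter_erase: "filter (\<lambda>c. c \<noteq> (0, 0)) (map (erase t) cs) = filter (visible (Suc t)) cs"
  by (induction cs) (auto simp: erase_def visible_def)

text \<open>
  This is what winding is for. The turn starting at \<open>a \<le> t\<close> consists of the letters from \<open>a\<close> to
  \<open>t - 1\<close>, then those from \<open>t\<close> to \<open>p - 1\<close>, then those below \<open>a\<close>; the first and the last part are
  invisible, and the middle part does not depend on \<open>a\<close>.
\<close>

lemma visible_winding:
  assumes "a \<le> t" "t < p"
  shows "filter (visible t) (zip (winding p a) (winding p a)) = map (\<lambda>s. (s, s)) [t..<p]"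
proof -
  have "winding p a = [a..<t] @ [t..<p] @ [0..<a]"
    using assms winding_eq_append[of a p] upt_add_eq_append[of a t "p - t"] by simp
  then show ?thesis
    using assms by (auto simp: zip_same_conv_map filter_map comp_def visible_def filter_empty_conv
        intro!: filter_True)
qed

lemma visible_zip_winding_erase:
  assumes "t < p"
  shows "filter (visible t) (zip (winding p (fst c)) (winding p (snd c)))
    = filter (visible t) (zip (winding p (fst (erase t c))) (winding p (snd (erase t c))))"
  using assms visible_winding[of "fst c" t p] visible_winding[of 0 t p]
  by (auto simp: erase_def visible_def)

lemma filter_zip_wind:
  "length u = length v \<Longrightarrow> filter P (zip (wind p u) (wind p v))
    = concat (map (\<lambda>c. filter P (zip (winding p (fst c)) (winding p (snd c)))) (zip u v))"
  by (induction u v rule: list_induct2) (auto simp: wind_def)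

text \<open>
  After winding, the diagonal columns up to \<open>(t, t)\<close> have become exchangeable for each other, but they
  cannot be moved yet, since their windings show the columns \<open>(t, t), ..., (p - 1, p - 1)\<close>.
\<close>

lemma wind_erase:
  assumes "t < p" "forgets_diagonal p t (p * M) R"
    and "u \<in> words {..<p} M" "v \<in> words {..<p} M" "u' \<in> words {..<p} M" "v' \<in> words {..<p} M"
    and "map (erase t) (zip u v) = map (erase t) (zip u' v')"
  shows "R (wind p u) (wind p v) = R (wind p u') (wind p v')"
proof -
  define F where "F c = filter (visible t) (zip (winding p (fst c)) (winding p (snd c)))" for c
  have F: "F = (\<lambda>c. F (erase t c))"
    unfolding F_def using visible_zip_winding_erase[OF assms(1)] by blast
  have "map F (zip u v) = map F (map (erase t) (zip u v))" for u v
    by (subst F) simp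
  then have "map F (zip u v) = map F (zip u' v')"
    using assms(7) by metis
  then have "filter (visible t) (zip (wind p u) (wind p v))
      = filter (visible t) (zip (wind p u') (wind p v'))"
    using assms(3-6) by (simp add: filter_zip_wind words_def F_def[abs_def])
  then show ?thesis
    using assms(1-6) wind_in_words[of p] unfolding forgets_diagonal_def by auto
qed

text \<open>
  The embedding is composed of three maps: spreading (chosen by Ramsey's theorem, which makes \<open>(0, 0)\<close>
  movable), winding (which makes the columns up to \<open>(t, t)\<close> exchangeable for \<open>(0, 0)\<close>) and the embedding
  of the previous stage. Their lengths are fixed in this order, before \<open>R\<close> is known; the maps
  themselves are chosen in the opposite order, since the relation to which Ramsey's theorem is applied
  is \<open>R\<close> pulled back along the other two.
\<close>

lemma forgets_diagonal_step:
  assumes "t < p"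
    and IH: "\<And>m. \<exists>N d. d > 0 \<and> (\<forall>R. \<exists>e. scaled_embedding p m N d e \<and> forgets_diagonal p t m (\<lambda>u v. R (e u) (e v)))"
  shows "\<exists>N d. d > 0 \<and> (\<forall>R. \<exists>e. scaled_embedding p m N d e \<and> forgets_diagonal p (Suc t) m (\<lambda>u v. R (e u) (e v)))"
proof -
  let ?K = "{..<p} \<times> {..<p}"
  have p: "0 < p" using assms(1) by simp
  have K: "finite ?K" "(0, 0) \<in> ?K" using p by auto
  obtain M where M: "\<forall>Q :: (nat \<times> nat) list \<Rightarrow> bool. \<exists>xs. sorted_wrt (<) xs \<and> set xs \<subseteq> {..<M} \<and> length xs = m \<and>
    (\<forall>cs\<in>words ?K m. \<forall>ds\<in>words ?K m. filter (\<lambda>c. c \<noteq> (0, 0)) cs = filter (\<lambda>c. c \<noteq> (0, 0)) ds \<longrightarrow>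
       Q (spread (0, 0) M xs cs) = Q (spread (0, 0) M xs ds))"
    by (rule exE[OF ramsey_blanks[OF K, of m]])
  obtain N d where d: "d > 0" and
    N: "\<And>R. \<exists>e. scaled_embedding p (p * M) N d e \<and> forgets_diagonal p t (p * M) (\<lambda>u v. R (e u) (e v))"
    using IH[of "p * M"] by (elim exE conjE) blast
  show ?thesis
  proof (rule exI[of _ N], rule exI[of _ "d * p * 1"], intro conjI allI)
    show "d * p * 1 > 0" using d p by simp
    fix R :: "nat list \<Rightarrow> nat list \<Rightarrow> bool"
    obtain e where e: "scaled_embedding p (p * M) N d e"
      "forgets_diagonal p t (p * M) (\<lambda>u v. R (e u) (e v))"
      using N by blast
    define R2 where "R2 u v = R (e (wind p u)) (e (wind p v))" for u v
    have R2: "R2 u v = R2 u' v'"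
      if "u \<in> words {..<p} M" "v \<in> words {..<p} M" "u' \<in> words {..<p} M" "v' \<in> words {..<p} M"
        "map (erase t) (zip u v) = map (erase t) (zip u' v')" for u v u' v'
      unfolding R2_def using wind_erase[OF assms(1) e(2) that] .
    define Q where "Q cs = R2 (map fst cs) (map snd cs)" for cs
    from M[THEN spec, of Q] obtain xs where xs: "sorted_wrt (<) xs" "set xs \<subseteq> {..<M}" "length xs = m"
      and Q: "\<And>cs ds. cs \<in> words ?K m \<Longrightarrow> ds \<in> words ?K m \<Longrightarrow>
        filter (\<lambda>c. c \<noteq> (0, 0)) cs = filter (\<lambda>c. c \<noteq> (0, 0)) ds \<Longrightarrow>
        Q (spread (0, 0) M xs cs) = Q (spread (0, 0) M xs ds)"
      by (elim exE conjE) blast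
    let ?e = "\<lambda>w. e (wind p (spread 0 M xs w))"
    have emb: "scaled_embedding p m N (d * p * 1) ?e"
      using scaled_embedding_comp[OF scaled_embedding_comp[OF e(1) scaled_embedding_wind[OF p]]
          scaled_embedding_spread[OF p xs(3) _ xs(2)]] xs(1) by (simp add: strict_sorted_iff)
    have er: "map (erase t) cs \<in> words ?K m" if "cs \<in> words ?K m" for cs
      using that p by (auto simp: words_def erase_def)
    have Qer: "Q (spread (0, 0) M xs cs) = Q (spread (0, 0) M xs (map (erase t) cs))"
      if cs: "cs \<in> words ?K m" for cs
    proof -
      have w: "map fst (spread (0, 0) M xs ds) \<in> words {..<p} M"
        "map snd (spread (0, 0) M xs ds) \<in> words {..<p} M" if "ds \<in> words ?K m" for ds
      proof -
        have "spread (0, 0) M xs ds \<in> words ?K M"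
          using spread_in_words[OF _ that] p by simp
        then show "map fst (spread (0, 0) M xs ds) \<in> words {..<p} M"
          "map snd (spread (0, 0) M xs ds) \<in> words {..<p} M"
          by (auto simp: words_def)
      qed
      have idem: "erase t (erase t c) = erase t c" "erase t (0, 0) = (0, 0)" for c
        by (auto simp: erase_def)
      show ?thesis
        unfolding Q_def using w[OF cs] w[OF er[OF cs]]
        by (intro R2) (auto simp: zip_map_fst_snd map_spread[of "erase t"] idem comp_def)
    qed
    have "forgets_diagonal p (Suc t) m (\<lambda>u v. R (?e u) (?e v))"
      unfolding forgets_diagonal_def
    proof (intro ballI impI)
      fix u v u' v'
      assume w: "u \<in> words {..<p} m" "v \<in> words {..<p} m" "u' \<in> words {..<p} m" "v' \<in> words {..<p} m"
        and eq: "filter (visible (Suc t)) (zip u v) = filter (visible (Suc t)) (zip u' v')"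
      have R: "R (?e u) (?e v) = Q (spread (0, 0) M xs (zip u v))"
        if "u \<in> words {..<p} m" "v \<in> words {..<p} m" for u v
        using that by (simp add: Q_def R2_def map_spread words_def)
      have z: "zip u v \<in> words ?K m" if "u \<in> words {..<p} m" "v \<in> words {..<p} m" for u v
        using that by (auto simp: words_def dest: set_zip_leftD set_zip_rightD)
      show "R (?e u) (?e v) = R (?e u') (?e v')"
        using Q[OF er[OF z[OF w(1,2)]] er[OF z[OF w(3,4)]]] eq
          Qer[OF z[OF w(1,2)]] Qer[OF z[OF w(3,4)]] R[OF w(1,2)] R[OF w(3,4)]
        by (simp add: filter_erase)
    qed
    with emb show "\<exists>e. scaled_embedding p m N (d * p * 1) e \<and> forgets_diagonal p (Suc t) m (\<lambda>u v. R (e u) (e v))"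
      by blast
  qed
qed

lemma ramsey_forgets_diagonal:
  assumes "t \<le> p"
  shows "\<exists>N d. d > 0 \<and> (\<forall>R. \<exists>e. scaled_embedding p m N d e \<and> forgets_diagonal p t m (\<lambda>u v. R (e u) (e v)))"
  using assms
proof (induction t arbitrary: m)
  case 0
  have vis: "filter (visible 0) cs = cs" for cs by (induction cs) (auto simp: visible_def)
  have "forgets_diagonal p 0 m R" for R
    unfolding forgets_diagonal_def vis
  proof (intro ballI impI)
    fix u v u' v'
    assume "u \<in> words {..<p} m" "v \<in> words {..<p} m" "u' \<in> words {..<p} m" "v' \<in> words {..<p} m"
      and eq: "zip u v = zip u' v'"
    then have "length u = length v" "length u' = length v'" by (auto simp: words_def)
    then have "u = u'" "v = v'" using eq by (metis map_fst_zip, metis map_snd_zip)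
    then show "R u v = R u' v'" by simp
  qed
  moreover have "scaled_embedding p m m 1 (\<lambda>w. w)"
    by (rule scaled_embeddingI) simp_all
  ultimately have "1 > (0::nat) \<and>
      (\<forall>R. \<exists>e. scaled_embedding p m m 1 e \<and> forgets_diagonal p 0 m (\<lambda>u v. R (e u) (e v)))"
    by (metis zero_less_one)
  then show ?case by blast
next
  case (Suc t)
  show ?case
    using Suc.prems Suc.IH by (intro forgets_diagonal_step) simp_all
qed

section \<open>Equivalence relations that do not see the diagonal\<close>

text \<open>
  Length \<open>m > p\<close> gives room for a full turn and one more letter, which is all that the insertion
  arguments below need.
\<close>

locale diagonal_blind =
  fixes p m :: nat and R :: "nat list \<Rightarrow> nat list \<Rightarrow> bool"
  assumes prime: "prime p" and room: "p < m"
    and R_refl: "u \<in> words {..<p} m \<Longrightarrow> R u u"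
    and R_sym: "R u v \<Longrightarrow> R v u"
    and R_trans: "R u v \<Longrightarrow> R v w \<Longrightarrow> R u w"
    and blind: "forgets_diagonal p p m R"
begin

lemma p_pos: "0 < p" and p_ge2: "2 \<le> p"
  using prime prime_ge_2_nat by (auto simp: prime_gt_0_nat)

text \<open>
  Since diagonal columns are invisible, a relation on words of length \<open>m\<close> compares shorter words as
  well, after filling them up with 0.
\<close>

definition pad :: "nat list \<Rightarrow> nat list" where
  "pad u = u @ replicate (m - length u) 0"

definition sim :: "nat list \<Rightarrow> nat list \<Rightarrow> bool" where
  "sim u v \<longleftrightarrow> R (pad u) (pad v)"

abbreviation short :: "nat list \<Rightarrow> bool" where
  "short u \<equiv> set u \<subseteq> {..<p} \<and> length u \<le> m"

lemma pad_in_words: "short u \<Longrightarrow> pad u \<in> words {..<p} m"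
  using p_pos by (auto simp: pad_def words_def)

lemma sim_refl: "short u \<Longrightarrow> sim u u"
  unfolding sim_def by (rule R_refl[OF pad_in_words])

lemma sim_sym: "sim u v \<Longrightarrow> sim v u"
  unfolding sim_def by (rule R_sym)

lemma sim_trans: "sim u v \<Longrightarrow> sim v w \<Longrightarrow> sim u w"
  unfolding sim_def by (rule R_trans)

lemma visible_zip_pad:
  assumes "set u \<subseteq> {..<p}" "length u = length v"
  shows "filter (visible p) (zip (pad u) (pad v)) = filter (\<lambda>c. fst c \<noteq> snd c) (zip u v)"
proof -
  have "filter (visible p) (zip u v) = filter (\<lambda>c. fst c \<noteq> snd c) (zip u v)"
    using assms(1) by (intro filter_cong) (auto simp: visible_def dest!: set_zip_leftD)
  then show ?thesis
    using assms p_pos by (simp add: pad_def zip_replicate visible_def)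
qed

lemma sim_eq:
  assumes "short u" "short v" "short u'" "short v'" "length u = length v" "length u' = length v'"
    and "filter (\<lambda>c. fst c \<noteq> snd c) (zip u v) = filter (\<lambda>c. fst c \<noteq> snd c) (zip u' v')"
  shows "sim u v = sim u' v'"
  using blind assms visible_zip_pad[of u v] visible_zip_pad[of u' v'] pad_in_words
  unfolding forgets_diagonal_def sim_def by simp

text \<open>
  The workhorse: a common subword may be inserted into, or deleted from, two words at the same place.
\<close>

lemma sim_insert:
  assumes "length u = length u'" "length v = length v'" "length u + length v + length x \<le> m"
    and "set u \<subseteq> {..<p}" "set v \<subseteq> {..<p}" "set u' \<subseteq> {..<p}" "set v' \<subseteq> {..<p}" "set x \<subseteq> {..<p}"
  shows "sim (u @ x @ v) (u' @ x @ v') = sim (u @ v) (u' @ v')"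
  using assms by (intro sim_eq) (auto simp: zip_same_conv_map filter_map comp_def)

definition commute :: "nat \<Rightarrow> nat \<Rightarrow> bool" where
  "commute a b \<longleftrightarrow> sim [a, b] [b, a]"

lemma commute_refl: "a < p \<Longrightarrow> commute a a"
  unfolding commute_def using p_ge2 room by (intro sim_refl) auto

text \<open>
  Move through \<open>abc\<close>, \<open>bac\<close>, \<open>cab\<close>, \<open>cba\<close>, then delete the common middle letter \<open>b\<close>. The step from
  \<open>bac\<close> to \<open>cab\<close> is the commutation of \<open>b\<close> and \<open>c\<close> with \<open>a\<close> inserted between them.
\<close>

lemma commute_trans:
  assumes "a < p" "b < p" "c < p" "commute a b" "commute b c"
  shows "commute a c"
proof -
  have m: "3 \<le> m" using p_ge2 room by simp
  have 1: "sim [a, b, c] [b, a, c]"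
    using sim_insert[of "[a, b]" "[b, a]" "[]" "[]" "[c]"] assms m by (simp add: commute_def)
  have 2: "sim [b, a, c] [c, a, b]"
    using sim_insert[of "[b]" "[c]" "[c]" "[b]" "[a]"] assms m by (simp add: commute_def)
  have 3: "sim [c, a, b] [c, b, a]"
    using sim_insert[of "[]" "[]" "[a, b]" "[b, a]" "[c]"] assms m by (simp add: commute_def)
  have "sim [a, b, c] [c, b, a]"
    by (rule sim_trans[OF 1 sim_trans[OF 2 3]])
  then show ?thesis
    using sim_insert[of "[a]" "[c]" "[c]" "[a]" "[b]"] assms m by (simp add: commute_def)
qed

text \<open>
  Insert \<open>b\<close> into both words, once after and once before the distinguished position. The right-hand
  word becomes the same word \<open>u' b b v'\<close> in both cases, hence \<open>u a b v\<close> and \<open>u b a v\<close> are related, and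
  the common parts \<open>u\<close> and \<open>v\<close> can be deleted.
\<close>

lemma sim_imp_commute:
  assumes "sim (u @ a # v) (u' @ b # v')"
    and len: "length u = length u'" "length v = length v'" "length u + length v + 2 \<le> m"
    and set: "set u \<subseteq> {..<p}" "set v \<subseteq> {..<p}" "set u' \<subseteq> {..<p}" "set v' \<subseteq> {..<p}" "a < p" "b < p"
  shows "commute a b"
proof -
  have 1: "sim (u @ a # b # v) (u' @ b # b # v')"
    using sim_insert[of "u @ [a]" "u' @ [b]" v v' "[b]"] assms by simp
  have 2: "sim (u @ b # a # v) (u' @ b # b # v')"
    using sim_insert[of u u' "a # v" "b # v'" "[b]"] assms by simp
  have "sim (u @ a # b # v) (u @ b # a # v)"
    by (rule sim_trans[OF 1 sim_sym[OF 2]])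
  moreover have "sim (u @ a # b # v) (u @ b # a # v) = sim ([] @ [a, b] @ v) ([] @ [b, a] @ v)"
    using len set by (intro sim_eq) (auto simp: zip_same_conv_map filter_map comp_def)
  moreover have "sim ([] @ [a, b] @ v) ([] @ [b, a] @ v) = commute a b"
    unfolding commute_def
    using len set by (intro sim_eq) (auto simp: zip_same_conv_map filter_map comp_def)
  ultimately show ?thesis by simp
qed

lemma sim_rotate1:
  assumes all: "\<And>a b. a < p \<Longrightarrow> b < p \<Longrightarrow> commute a b"
    and "set xs \<subseteq> {..<p}" "x < p" "length xs < m"
  shows "sim (x # xs) (xs @ [x])"
  using assms(2-4)
proof (induction xs)
  case Nil
  then show ?case by (simp add: sim_refl)
next
  case (Cons y ys)
  have 1: "sim (x # y # ys) (y # x # ys)"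
    using all[of x y] sim_insert[of "[x, y]" "[y, x]" "[]" "[]" ys] Cons.prems
    by (simp add: commute_def)
  have 2: "sim (y # x # ys) (y # ys @ [x])"
    using Cons.IH sim_insert[of "[]" "[]" "x # ys" "ys @ [x]" "[y]"] Cons.prems by simp
  show ?case
    using sim_trans[OF 1 2] by simp
qed

lemma short_winding: "short (winding p a)"
  using set_winding[OF p_pos] room by simp

text \<open>
  Consecutive windings differ by one cyclic shift, which is a sequence of transpositions of
  neighbouring letters.
\<close>

lemma sim_windings:
  assumes all: "\<And>a b. a < p \<Longrightarrow> b < p \<Longrightarrow> commute a b"
  shows "sim (winding p i) (winding p j)"
proof -
  have "sim (winding p 0) (winding p k)" for k
  proof (induction k)
    case 0
    show ?case by (rule sim_refl[OF short_winding])
  next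
    case (Suc k)
    obtain x xs where x: "winding p k = x # xs"
      using p_pos by (metis length_winding list.exhaust list.size(3) less_irrefl)
    have "winding p (Suc k) = xs @ [x]"
      using x by (simp add: winding_eq_rotate)
    then have "sim (winding p k) (winding p (Suc k))"
      using sim_rotate1[OF all, of xs x] short_winding[of k] x by simp
    then show ?case
      by (rule sim_trans[OF Suc.IH])
  qed
  then show ?thesis
    by (meson sim_trans sim_sym)
qed

text \<open>
  This is where primality enters: the multiples of a nonzero \<open>d\<close> exhaust the residues modulo \<open>p\<close>, so
  transitivity carries \<open>a\<close> to every \<open>b\<close>.
\<close>

lemma commute_all:
  assumes d: "0 < d" "d < p" and step: "\<And>a. a < p \<Longrightarrow> commute a ((a + d) mod p)"
    and "a < p" "b < p"
  shows "commute a b"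
proof -
  have 1: "commute a ((a + k * d) mod p)" for k
  proof (induction k)
    case 0
    then show ?case using assms commute_refl by simp
  next
    case (Suc k)
    have "commute ((a + k * d) mod p) (((a + k * d) mod p + d) mod p)"
      using step p_pos by simp
    moreover have "((a + k * d) mod p + d) mod p = (a + Suc k * d) mod p"
      by (simp add: mod_simps algebra_simps)
    ultimately show ?case
      using commute_trans[OF _ _ _ Suc.IH] assms(4) p_pos by simp
  qed
  have "coprime d p"
    using d prime by (metis coprime_commute nat_dvd_not_less prime_imp_coprime)
  then obtain x where x: "[d * x = Suc 0] (mod p)"
    using cong_solve_coprime_nat by blast
  define k where "k = x * (b + (p - a))"
  have "[d * x * (b + (p - a)) = Suc 0 * (b + (p - a))] (mod p)"
    by (rule cong_scalar_right[OF x])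
  then have "[a + k * d = a + (b + (p - a))] (mod p)"
    by (simp add: k_def mult_ac cong_add_lcancel_nat)
  also have "a + (b + (p - a)) = b + p" using assms by simp
  finally have "(a + k * d) mod p = b"
    using assms(5) unfolding unique_euclidean_semiring_class.cong_def by simp
  then show ?thesis using 1[of k] by simp
qed

text \<open>
  If the windings starting at \<open>i \<noteq> j\<close> are related, then comparing them letter by letter shows that every
  letter \<open>x\<close> commutes with \<open>x + (j - i)\<close> modulo \<open>p\<close>, since \<open>x\<close> does occur in a full turn.
\<close>

lemma windings_mono_or_rainbow:
  "(\<forall>i<p. \<forall>j<p. sim (winding p i) (winding p j)) \<or>
   (\<forall>i<p. \<forall>j<p. i \<noteq> j \<longrightarrow> \<not> sim (winding p i) (winding p j))"
proof (cases "\<forall>a<p. \<forall>b<p. commute a b")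
  case True
  then show ?thesis using sim_windings by blast
next
  case False
  have "commute a b" if ij: "i < p" "j < p" "i \<noteq> j" "sim (winding p i) (winding p j)"
    and ab: "a < p" "b < p" for i j a b
  proof (rule commute_all[of "(j + (p - i)) mod p", OF _ _ _ ab])
    show "0 < (j + (p - i)) mod p"
    proof (cases "i < j")
      case True
      then obtain q where q: "j = i + q" "0 < q" using less_imp_add_positive by blast
      then have "j + (p - i) = q + p" using ij(1) by simp
      then show ?thesis using q ij(2) by simp
    next
      case False
      then have "j + (p - i) < p" using ij(1,3) by simp
      then show ?thesis using ij(1) by (simp add: mod_less)
    qed
    show "(j + (p - i)) mod p < p" using p_pos by simp
    show "commute x ((x + (j + (p - i)) mod p) mod p)" if "x < p" for x
    proof -
      \<comment> \<open>the place at which the turn starting at \<open>i\<close> passes through \<open>x\<close>\<close>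
      define s where "s = (x + (p - i)) mod p"
      have s: "s < p" using p_pos by (simp add: s_def)
      have "(i + s) mod p = (i + (x + (p - i))) mod p" by (simp add: s_def mod_add_right_eq)
      also have "i + (x + (p - i)) = x + p" using ij(1) by simp
      finally have x: "(i + s) mod p = x" using \<open>x < p\<close> by simp
      have y: "(j + s) mod p = (x + (j + (p - i)) mod p) mod p"
        by (simp add: s_def mod_simps ac_simps)
      have split: "winding p k = map (\<lambda>s. (k + s) mod p) [0..<s] @ (k + s) mod p #
          map (\<lambda>s. (k + s) mod p) [Suc s..<p]" for k
        using s upt_add_eq_append[of 0 s "p - s"]
        by (simp add: winding_def upt_conv_Cons)
      have "commute ((i + s) mod p) ((j + s) mod p)"
        by (rule sim_imp_commute[OF ij(4)[unfolded split]]) (use s room p_pos in auto)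
      then show ?thesis using x y by simp
    qed
  qed
  then show ?thesis using False by blast
qed

end

text \<open>
  The combinatorial core. The enlargement factor \<open>d\<close> is fixed before the relation \<open>R\<close>, so the
  polygon from which the words are built can be shrunk in advance to compensate for it.
\<close>

lemma canonical_words:
  assumes "prime p"
  shows "\<exists>N d. 0 < d \<and> (\<forall>R. (\<forall>w\<in>words {..<p} N. R w w) \<and> symp R \<and> transp R \<longrightarrow>
    (\<exists>x. (\<forall>i<p. x i \<in> words {..<p} N) \<and>
      (\<forall>g. rotation_invariant p g \<longrightarrow> (\<forall>i<p. \<forall>j<p. wdist g (x i) (x j) = real d * g i j)) \<and>
      ((\<forall>i<p. \<forall>j<p. R (x i) (x j)) \<or> (\<forall>i<p. \<forall>j<p. i \<noteq> j \<longrightarrow> \<not> R (x i) (x j)))))"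
proof -
  have p: "0 < p" using assms by (simp add: prime_gt_0_nat)
  obtain N d where d: "d > 0" and
    N: "\<And>R. \<exists>e. scaled_embedding p (Suc p) N d e \<and> forgets_diagonal p p (Suc p) (\<lambda>u v. R (e u) (e v))"
    using ramsey_forgets_diagonal[OF le_refl[of p], of "Suc p"] by (elim exE conjE) blast
  show ?thesis
  proof (rule exI[of _ N], rule exI[of _ "d * p"], intro conjI allI impI)
    show "0 < d * p" using d p by simp
    fix R assume R: "(\<forall>w\<in>words {..<p} N. R w w) \<and> symp R \<and> transp R"
    obtain e where e: "scaled_embedding p (Suc p) N d e"
      "forgets_diagonal p p (Suc p) (\<lambda>u v. R (e u) (e v))"
      using N by blast
    interpret diagonal_blind p "Suc p" "\<lambda>u v. R (e u) (e v)"
    proof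
      show "prime p" by fact
      show "forgets_diagonal p p (Suc p) (\<lambda>u v. R (e u) (e v))" by (rule e(2))
      show "R (e u) (e u)" if "u \<in> words {..<p} (Suc p)" for u
        using R scaled_embeddingD(1)[OF e(1) that] by blast
      show "R (e v) (e u)" if "R (e u) (e v)" for u v
        using R that by (blast dest: sympD)
      show "R (e u) (e w)" if "R (e u) (e v)" "R (e v) (e w)" for u v w
        using R that by (blast dest: transpD)
    qed simp
    have "wdist g (e (pad (winding p i))) (e (pad (winding p j))) = real (d * p) * g i j"
      if g: "rotation_invariant p g" and "i < p" "j < p" for g i j
    proof -
      have "g 0 0 = 0" using g unfolding rotation_invariant_def by blast
      then have "wdist g (pad (winding p i)) (pad (winding p j)) = wdist g (winding p i) (winding p j)"
        by (simp add: pad_def wdist_append) (simp add: wdist_def)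
      then show ?thesis
        using scaled_embeddingD(2)[OF e(1) pad_in_words[OF short_winding] g pad_in_words[OF short_winding]]
          wdist_winding[OF that] by simp
    qed
    moreover have "e (pad (winding p i)) \<in> words {..<p} N" for i
      by (rule scaled_embeddingD(1)[OF e(1) pad_in_words[OF short_winding]])
    ultimately show "\<exists>x. (\<forall>i<p. x i \<in> words {..<p} N) \<and>
      (\<forall>g. rotation_invariant p g \<longrightarrow> (\<forall>i<p. \<forall>j<p. wdist g (x i) (x j) = real (d * p) * g i j)) \<and>
      ((\<forall>i<p. \<forall>j<p. R (x i) (x j)) \<or> (\<forall>i<p. \<forall>j<p. i \<noteq> j \<longrightarrow> \<not> R (x i) (x j)))"
      using windings_mono_or_rainbow unfolding sim_def
      by (intro exI[of _ "\<lambda>i. e (pad (winding p i))"] conjI allI impI)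
  qed
qed

section \<open>From words to points\<close>

definition vertex :: "nat \<Rightarrow> nat \<Rightarrow> complex" where
  "vertex p k = cis (2 * pi * real k / real p)"

definition chord :: "nat \<Rightarrow> nat \<Rightarrow> nat \<Rightarrow> real" where
  "chord p a b = (cmod (vertex p a - vertex p b))\<^sup>2"

lemma vertex_add: "vertex p (a + s) = vertex p a * vertex p s"
  by (simp add: vertex_def cis_mult add_divide_distrib distrib_left)

lemma vertex_mod:
  assumes "0 < p"
  shows "vertex p (k mod p) = vertex p k"
proof -
  have turn: "vertex p (p * q) = 1" for q
  proof -
    have "2 * pi * real (p * q) / real p = 2 * pi * real q" using assms by simp
    then show ?thesis unfolding vertex_def by (simp only: cis_multiple_2pi[OF Ints_of_nat])
  qed
  have "vertex p (k mod p + p * (k div p)) = vertex p (k mod p)"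
    by (simp only: vertex_add turn mult_1_right)
  then show ?thesis by simp
qed

lemma rotation_invariant_chord:
  assumes "0 < p"
  shows "rotation_invariant p (chord p)"
proof -
  have "chord p ((a + s) mod p) ((b + s) mod p) = chord p a b" for a b s
  proof -
    have "vertex p ((a + s) mod p) - vertex p ((b + s) mod p) = (vertex p a - vertex p b) * vertex p s"
      by (simp add: vertex_mod[OF assms] vertex_add algebra_simps)
    moreover have "cmod (vertex p s) = 1" by (simp add: vertex_def)
    ultimately show ?thesis by (simp add: chord_def norm_mult)
  qed
  then show ?thesis by (simp add: rotation_invariant_def chord_def)
qed

text \<open>
  A word of length \<open>N\<close> becomes a point of the product of \<open>N\<close> planes, the coordinates \<open>2 * k\<close> and
  \<open>2 * k + 1\<close> being those of the vertex \<open>w ! k\<close> of a regular \<open>p\<close>-gon of circumradius \<open>\<rho>\<close>.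
\<close>

definition word_point :: "nat \<Rightarrow> real \<Rightarrow> nat list \<Rightarrow> nat \<Rightarrow> real" where
  "word_point p \<rho> w i = (if i < 2 * length w then
     \<rho> * (if even i then Re (vertex p (w ! (i div 2))) else Im (vertex p (w ! (i div 2)))) else 0)"

lemma sum_lessThan_double: "(\<Sum>i<2 * n. f i) = (\<Sum>k<n. f (2 * k) + f (2 * k + 1 :: nat) :: real)"
  by (induction n) simp_all

lemma wdist_eq_sum:
  "length u = n \<Longrightarrow> length v = n \<Longrightarrow> wdist g u v = (\<Sum>k<n. g (u ! k) (v ! k))"
  by (simp add: wdist_def sum_list_sum_nth atLeast0LessThan)

lemma edist_word_point:
  assumes "length u = N" "length v = N" "0 < \<rho>"
  shows "edist (2 * N + 1) (word_point p \<rho> u) (word_point p \<rho> v) = \<rho> * sqrt (wdist (chord p) u v)"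
proof -
  let ?D = "\<lambda>i. (word_point p \<rho> u i - word_point p \<rho> v i)\<^sup>2"
  have "?D (2 * k) + ?D (2 * k + 1) = \<rho>\<^sup>2 * chord p (u ! k) (v ! k)" if "k < N" for k
    using that assms(1,2)
    by (simp add: word_point_def chord_def cmod_power2 power_mult_distrib flip: right_diff_distrib)
      (simp add: algebra_simps)
  then have "(\<Sum>i<2 * N. ?D i) = \<rho>\<^sup>2 * wdist (chord p) u v"
    unfolding sum_lessThan_double wdist_eq_sum[OF assms(1,2)] sum_distrib_left
    by (intro sum.cong) auto
  moreover have "?D (2 * N) = 0" using assms by (simp add: word_point_def)
  ultimately have "(\<Sum>i<2 * N + 1. ?D i) = \<rho>\<^sup>2 * wdist (chord p) u v" by simp
  then show ?thesis
    using assms(3) by (simp add: edist_def L2_set_def real_sqrt_mult)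
qed

lemma edist_polygon_vertices:
  assumes "0 < r"
  shows "edist 2 (\<lambda>i. if i = 0 then a + r * cos (t + 2 * pi * real j / real p)
      else if i = 1 then b + r * sin (t + 2 * pi * real j / real p) else 0)
    (\<lambda>i. if i = 0 then a + r * cos (t + 2 * pi * real k / real p)
      else if i = 1 then b + r * sin (t + 2 * pi * real k / real p) else 0)
    = r * sqrt (chord p j k)"
proof -
  let ?z = "\<lambda>k. cis (t + 2 * pi * real k / real p)"
  have "?z k = cis t * vertex p k" for k by (simp add: vertex_def cis_mult)
  then have "?z j - ?z k = cis t * (vertex p j - vertex p k)" by (simp add: right_diff_distrib)
  then have "cmod (?z j - ?z k) = cmod (vertex p j - vertex p k)" by (simp add: norm_mult)
  then have "chord p j k = (cos (t + 2 * pi * real j / real p) - cos (t + 2 * pi * real k / real p))\<^sup>2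
      + (sin (t + 2 * pi * real j / real p) - sin (t + 2 * pi * real k / real p))\<^sup>2"
    unfolding chord_def cmod_power2[of "?z j - ?z k", symmetric, simplified]
    by (metis cmod_power2 cis.sel minus_complex.sel)
  then have "r\<^sup>2 * chord p j k
      = (r * cos (t + 2 * pi * real j / real p) - r * cos (t + 2 * pi * real k / real p))\<^sup>2
      + (r * sin (t + 2 * pi * real j / real p) - r * sin (t + 2 * pi * real k / real p))\<^sup>2"
    by (simp add: power_mult_distrib distrib_left flip: right_diff_distrib)
  then have "r * sqrt (chord p j k)
      = sqrt ((r * cos (t + 2 * pi * real j / real p) - r * cos (t + 2 * pi * real k / real p))\<^sup>2
      + (r * sin (t + 2 * pi * real j / real p) - r * sin (t + 2 * pi * real k / real p))\<^sup>2)"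
    using assms by (metis abs_of_pos real_sqrt_abs real_sqrt_mult)
  moreover have "{..<2::nat} = {0, 1}" by auto
  ultimately show ?thesis by (simp add: edist_def L2_set_def)
qed

theorem theorem1:
  fixes p :: nat and C :: "(nat \<Rightarrow> real) set"
  assumes "prime p"
    and "regular_polygon p C"
  shows "canonically_Ramsey 2 C"
proof -
  have p: "0 < p" using assms(1) by (simp add: prime_gt_0_nat)
  obtain a b r t where r: "r > 0" and C_def: "C = (\<lambda>k i. if i = 0 then a + r * cos (t + 2 * pi * real k / real p)
                   else if i = 1 then b + r * sin (t + 2 * pi * real k / real p)
                   else 0) ` {..<p}" (is "_ = ?c ` _")
    using assms(2) unfolding regular_polygon_def by (elim exE conjE)
  define c where "c = ?c"
  have C: "C = c ` {..<p}" unfolding c_def by (rule C_def)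
  have inj: "inj_on c {..<p}"
    using card_regular_polygon[OF assms(2)] unfolding C by (intro eq_card_imp_inj_on) simp_all
  have dist_c: "edist 2 (c j) (c k) = r * sqrt (chord p j k)" for j k
    unfolding c_def by (rule edist_polygon_vertices[OF r])
  obtain N d where d: "0 < d" and N: "\<And>R. (\<forall>w\<in>words {..<p} N. R w w) \<and> symp R \<and> transp R \<Longrightarrow>
    \<exists>x. (\<forall>i<p. x i \<in> words {..<p} N) \<and>
      (\<forall>g. rotation_invariant p g \<longrightarrow> (\<forall>i<p. \<forall>j<p. wdist g (x i) (x j) = real d * g i j)) \<and>
      ((\<forall>i<p. \<forall>j<p. R (x i) (x j)) \<or> (\<forall>i<p. \<forall>j<p. i \<noteq> j \<longrightarrow> \<not> R (x i) (x j)))"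
    using canonical_words[OF assms(1)] by (elim exE conjE) blast
  \<comment> \<open>squared distances in the copy are \<open>d\<close> times those of the small polygon\<close>
  define \<rho> where "\<rho> = r / sqrt d"
  have \<rho>: "0 < \<rho>" using r d by (simp add: \<rho>_def)
  \<comment> \<open>one coordinate more than \<open>2 * N\<close>, which keeps the dimension positive even if \<open>N = 0\<close>\<close>
  define S where "S = word_point p \<rho> ` words {..<p} N"
  have "configuration (2 * N + 1) S"
    unfolding configuration_def S_def
    using finite_words[of "{..<p}" N]
    by (auto simp: topspace_Euclidean_space word_point_def words_def)
  moreover have "\<exists>X. copy_in 2 C (2 * N + 1) S X \<and> (Defs.monochromatic R X \<or> rainbow R X)"
    if R: "equiv S R" for R
  proof -
    define R' where "R' u v \<longleftrightarrow> (word_point p \<rho> u, word_point p \<rho> v) \<in> R" for u v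
    have "R' w w" if "w \<in> words {..<p} N" for w
      using R that unfolding R'_def S_def equiv_def by (auto dest: refl_onD)
    moreover have "symp R'"
      using R unfolding R'_def equiv_def by (auto intro!: sympI dest: symD)
    moreover have "transp R'"
      using R unfolding R'_def equiv_def by (auto intro!: transpI dest: transD)
    ultimately obtain x where x: "\<forall>i<p. x i \<in> words {..<p} N"
      and dist_x: "\<forall>g. rotation_invariant p g \<longrightarrow> (\<forall>i<p. \<forall>j<p. wdist g (x i) (x j) = real d * g i j)"
      and col: "(\<forall>i<p. \<forall>j<p. R' (x i) (x j)) \<or> (\<forall>i<p. \<forall>j<p. i \<noteq> j \<longrightarrow> \<not> R' (x i) (x j))"
      using N[of R'] by (elim exE conjE meta_impE) blast+
    define y where "y k = word_point p \<rho> (x k)" for k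
    have dist_y: "edist (2 * N + 1) (y j) (y k) = edist 2 (c j) (c k)" if "j < p" "k < p" for j k
    proof -
      have "length (x j) = N" "length (x k) = N" using x that by (auto simp: words_def)
      then have "edist (2 * N + 1) (y j) (y k) = \<rho> * sqrt (real d * chord p j k)"
        using edist_word_point \<rho> dist_x rotation_invariant_chord[OF p] that by (simp add: y_def)
      then show ?thesis using d by (simp add: dist_c \<rho>_def real_sqrt_mult)
    qed
    define f where "f = y \<circ> inv_into {..<p} c"
    have f: "f (c k) = y k" if "k < p" for k
      using inj that by (simp add: f_def)
    have "f ` C = y ` {..<p}"
      unfolding C image_image using f by (intro image_cong) auto
    moreover have "\<forall>u\<in>C. \<forall>v\<in>C. edist (2 * N + 1) (f u) (f v) = edist 2 u v"
      using f dist_y by (auto simp: C)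
    moreover have "y ` {..<p} \<subseteq> S" using x by (auto simp: y_def S_def)
    ultimately have "copy_in 2 C (2 * N + 1) S (y ` {..<p})"
      unfolding copy_in_def by blast
    moreover have "Defs.monochromatic R (y ` {..<p}) \<or> rainbow R (y ` {..<p})"
      using col unfolding Defs.monochromatic_def rainbow_def R'_def y_def by blast
    ultimately show ?thesis by blast
  qed
  ultimately show ?thesis
    unfolding canonically_Ramsey_def by (intro exI[of _ "2 * N + 1"] exI[of _ S]) auto
qed

end
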